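(* Every Hilbert $C^*$-module $V$ over any $C^*$-algebra $A$ has the property (mBS1): every $\tau_{\widehat V}$-null sequence $\{x_n\}$ in $V$ admits a subsequence $\{x_{n(i)}\}$ such that $$\lim_{k\to\infty}\Bigl\|\frac1k\sum_{i=1}^k x_{n(i)}\Bigr\|=0.$$
   Context: Hilbert modules are right Hilbert $C^*$-modules, with $A$-valued inner product $\langle\cdot,\cdot\rangle$ that is $A$-linear in the second variable and norm $\|x\|=\|\langle x,x\rangle\|^{1/2}$. The topology $\tau_{\widehat V}$ on $V$ is the locally convex topology generated by the seminorms $x\mapsto\|\langle z,x\rangle\|$, $z\in V$. A sequence $\{x_n\}$ in $V$ is $\tau_{\widehat V}$-null if $\|\langle z,x_n\rangle\|\to0$ for every $z\in V$. *)

theory Defs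
  imports Complex_Main
begin

text \<open>Complex Banach spaces; the real structure inherited from the class \<open>banach\<close> is required
  to be the restriction of the complex one.\<close>

class complex_banach = banach +
  fixes scaleC :: "complex \<Rightarrow> 'a \<Rightarrow> 'a"  (infixr \<open>*\<^sub>C\<close> 75)
  assumes scaleC_add_right: "c *\<^sub>C (x + y) = c *\<^sub>C x + c *\<^sub>C y"
    and scaleC_add_left: "(c + d) *\<^sub>C x = c *\<^sub>C x + d *\<^sub>C x"
    and scaleC_scaleC: "c *\<^sub>C d *\<^sub>C x = (c * d) *\<^sub>C x"
    and scaleC_of_real: "complex_of_real r *\<^sub>C x = r *\<^sub>R x"
    and norm_scaleC: "norm (c *\<^sub>C x) = cmod c * norm x"

text \<open>C*-algebras. No unit is required; submultiplicativity of the norm comes from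
  \<open>real_normed_algebra\<close>.\<close>

class cstar_algebra = complex_banach + real_normed_algebra +
  fixes star :: "'a \<Rightarrow> 'a"
  assumes mult_scaleC_left: "(c *\<^sub>C a) * b = c *\<^sub>C (a * b)"
    and mult_scaleC_right: "a * (c *\<^sub>C b) = c *\<^sub>C (a * b)"
    and star_add: "star (a + b) = star a + star b"
    and star_scaleC: "star (c *\<^sub>C a) = cnj c *\<^sub>C star a"
    and star_mult: "star (a * b) = star b * star a"
    and star_star: "star (star a) = a"
    and cstar_identity: "norm (star a * a) = (norm a)\<^sup>2"

definition cstar_positive :: "'a::cstar_algebra \<Rightarrow> bool" where
  "cstar_positive a \<longleftrightarrow> (\<exists>b. a = star b * b)"

text \<open>Right Hilbert modules \<open>V = 'v\<close> over \<open>A = 'a\<close>: \<open>act\<close> is the right action and \<open>ip\<close> the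
  \<open>A\<close>-valued inner product, linear in the second variable. Completeness in the module norm is
  expressed by \<open>norm_eq\<close>, which identifies the norm of the Banach space \<open>V\<close> with
  \<open>\<parallel>\<langle>x,x\<rangle>\<parallel>\<^sup>1\<^sup>/\<^sup>2\<close>.\<close>

locale hilbert_cstar_module =
  fixes act :: "'v::complex_banach \<Rightarrow> 'a::cstar_algebra \<Rightarrow> 'v"
    and ip :: "'v \<Rightarrow> 'v \<Rightarrow> 'a"
  assumes act_add_left: "act (x + y) a = act x a + act y a"
    and act_add_right: "act x (a + b) = act x a + act x b"
    and act_mult: "act x (a * b) = act (act x a) b"
    and act_scaleC_left: "act (c *\<^sub>C x) a = c *\<^sub>C act x a"
    and act_scaleC_right: "act x (c *\<^sub>C a) = c *\<^sub>C act x a"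
    and ip_add_right: "ip x (y + z) = ip x y + ip x z"
    and ip_scaleC_right: "ip x (c *\<^sub>C y) = c *\<^sub>C ip x y"
    and ip_act_right: "ip x (act y a) = ip x y * a"
    and ip_star: "star (ip x y) = ip y x"
    and ip_positive: "cstar_positive (ip x x)"
    and ip_definite: "ip x x = 0 \<Longrightarrow> x = 0"
    and norm_eq: "norm x = sqrt (norm (ip x x))"

text \<open>Null sequences for the topology generated by the seminorms \<open>x \<mapsto> \<parallel>\<langle>z,x\<rangle>\<parallel>\<close>.\<close>

definition tau_null :: "('v \<Rightarrow> 'v \<Rightarrow> 'a::real_normed_vector) \<Rightarrow> (nat \<Rightarrow> 'v) \<Rightarrow> bool" where
  "tau_null ip x \<longleftrightarrow> (\<forall>z. (\<lambda>n. norm (ip z (x n))) \<longlonglongrightarrow> 0)"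

definition mBS1 :: "('v::real_normed_vector \<Rightarrow> 'v \<Rightarrow> 'a::real_normed_vector) \<Rightarrow> bool" where
  "mBS1 ip \<longleftrightarrow> (\<forall>x. tau_null ip x \<longrightarrow>
     (\<exists>r :: nat \<Rightarrow> nat. strict_mono r \<and>
        (\<lambda>k. norm ((1 / real k) *\<^sub>R (\<Sum>i = 1..k. x (r i)))) \<longlonglongrightarrow> 0))"

end

theory Submission
  imports Defs
begin

text \<open>A \<open>\<tau>\<close>-null sequence has, after passing to a subsequence \<open>y\<close>, summably small mutual inner
  products: \<open>\<parallel>\<langle>y\<^sub>i,y\<^sub>j\<rangle>\<parallel> \<le> 2\<^sup>-\<^sup>j\<close> for \<open>i \<noteq> j\<close>. If the sequence were unbounded, one could also arrange
  \<open>\<parallel>y\<^sub>k\<parallel> \<ge> 4\<^sup>k\<close>; then \<open>z = \<Sum> 2\<^sup>-\<^sup>k y\<^sub>k / \<parallel>y\<^sub>k\<parallel>\<close> would satisfy \<open>\<parallel>\<langle>z,y\<^sub>k\<rangle>\<parallel> \<ge> 2\<^sup>k - 2\<close>, contradicting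
  nullity. So the sequence is bounded by some \<open>M\<close>, and expanding
  \<open>\<parallel>y\<^sub>1 + \<dots> + y\<^sub>k\<parallel>\<^sup>2 = \<parallel>\<Sum> \<langle>y\<^sub>i,y\<^sub>j\<rangle>\<parallel> \<le> k (M\<^sup>2 + 2)\<close> shows that the Cesaro means tend to zero.\<close>

text \<open>When index k is chosen, only the finitely many conditions \<open>R k (r j)\<close> with
  j < k are pending. Each holds eventually, so their conjunction meets \<open>P k\<close> infinitely
  often. \<open>R\<close> depends on k so that tolerances can shrink along the subsequence.\<close>

lemma exists_subseq_frequently_eventually:
  fixes P :: "nat \<Rightarrow> nat \<Rightarrow> bool" and R :: "nat \<Rightarrow> nat \<Rightarrow> nat \<Rightarrow> bool"
  assumes P: "\<And>k. \<exists>\<^sub>F n in sequentially. P k n"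
    and R: "\<And>k m. \<forall>\<^sub>F n in sequentially. R k m n"
  obtains r :: "nat \<Rightarrow> nat"
  where "strict_mono r" "\<And>k. P k (r k)" "\<And>j k. j < k \<Longrightarrow> R k (r j) (r k)"
proof -
  have "\<exists>r. \<forall>k. P k (r k) \<and> (\<forall>j<k. r j < r k \<and> R k (r j) (r k))"
  proof (rule dependent_wellorder_choice)
    fix f :: "nat \<Rightarrow> nat" and k
    have "\<forall>\<^sub>F n in sequentially. \<forall>j\<in>{..<k}. f j < n \<and> R k (f j) n"
      by (intro eventually_ball_finite ballI eventually_conj R eventually_gt_at_top) auto
    from frequently_eventually_frequently[OF P this, of k]
    show "\<exists>n. P k n \<and> (\<forall>j<k. f j < n \<and> R k (f j) n)"
      by (auto dest!: frequently_ex)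
  qed auto
  then show thesis
    using that by (auto simp: strict_mono_def)
qed

text \<open>The C*-identity and submultiplicativity give one inequality after cancelling
  \<open>norm b\<close>; applying it to \<open>star a\<close> gives the other.\<close>

lemma norm_star [simp]: "norm (star a) = norm (a :: 'a::cstar_algebra)"
proof -
  have le: "norm b \<le> norm (star b)" for b :: 'a
  proof (cases "b = 0")
    case False
    have "norm b * norm b \<le> norm (star b) * norm b"
      using norm_mult_ineq[of "star b" b] by (simp add: cstar_identity power2_eq_square)
    then show ?thesis
      using False by simp
  qed simp
  from le[of a] le[of "star a"] show ?thesis
    by (simp add: star_star)
qed

context hilbert_cstar_module
begin

lemma ip_add_left: "ip (x + y) z = ip x z + ip y z"
  by (metis ip_add_right ip_star star_add)

lemma ip_scaleC_left: "ip (c *\<^sub>C x) y = cnj c *\<^sub>C ip x y"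
  by (metis ip_scaleC_right ip_star star_scaleC)

lemma ip_scaleR_left: "ip (r *\<^sub>R x) y = r *\<^sub>R ip x y"
  using ip_scaleC_left[of "complex_of_real r" x y] by (simp add: scaleC_of_real)

lemma ip_scaleR_right: "ip x (r *\<^sub>R y) = r *\<^sub>R ip x y"
  using ip_scaleC_right[of x "complex_of_real r" y] by (simp add: scaleC_of_real)

lemma norm_ip_commute: "norm (ip x y) = norm (ip y x)"
  by (metis ip_star norm_star)

lemma norm_ip_self: "norm (ip x x) = (norm x)\<^sup>2"
  by (simp add: norm_eq)

text \<open>Polarization at unit vectors; the constant 6 is not sharp, but it suffices for continuity.\<close>

lemma norm_ip_le: "norm (ip x y) \<le> 6 * norm x * norm y"
proof -
  \<comment> \<open>The bound is 4 + 1 + 1, from the squared norms of u + v, u and v.\<close>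
  have sym: "norm (ip u v + ip v u) \<le> 6" if "norm u = 1" "norm v = 1" for u v
  proof -
    have "norm (u + v) \<le> 2"
      using norm_triangle_ineq[of u v] that by simp
    then have "(norm (u + v))\<^sup>2 \<le> 4"
      using power_mono[of "norm (u + v)" 2 2] by simp
    moreover have "ip u v + ip v u = ip (u + v) (u + v) - ip u u - ip v v"
      by (simp add: ip_add_left ip_add_right algebra_simps)
    moreover have "norm (ip (u + v) (u + v) - ip u u - ip v v)
        \<le> norm (ip (u + v) (u + v)) + norm (ip u u) + norm (ip v v)"
      by (smt (verit) norm_triangle_ineq4)
    ultimately show ?thesis
      using that by (simp add: norm_ip_self)
  qed
  have unit: "norm (ip u v) \<le> 6" if u: "norm u = 1" and v: "norm v = 1" for u v
  proof -
    have minus: "c *\<^sub>C (- a) = - (c *\<^sub>C a)" "(- c) *\<^sub>C a = - (c *\<^sub>C a)" for c and a :: 'a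
      using scaleC_scaleC[of c "complex_of_real (-1)" a]
        scaleC_scaleC[of "complex_of_real (-1)" c a]
      by (simp_all only: scaleC_of_real) (simp_all add: mult.commute)
    \<comment> \<open>Multiplying the unit vector v by \<i> turns the symmetric sum into a
      difference of the same norm bound. Sum and difference together isolate twice
      \<open>ip u v\<close>.\<close>
    have "ip u (\<i> *\<^sub>C v) + ip (\<i> *\<^sub>C v) u = \<i> *\<^sub>C (ip u v - ip v u)"
      by (simp only: ip_scaleC_left ip_scaleC_right diff_conv_add_uminus scaleC_add_right minus
          complex_cnj_i)
    then have "norm (ip u v - ip v u) \<le> 6"
      using sym[of u "\<i> *\<^sub>C v"] u v by (simp add: norm_scaleC)
    moreover have "ip u v + ip u v = (ip u v + ip v u) + (ip u v - ip v u)"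
      by simp
    then have "norm (ip u v + ip u v) \<le> norm (ip u v + ip v u) + norm (ip u v - ip v u)"
      by (metis norm_triangle_ineq)
    moreover have "norm (ip u v + ip u v) = 2 * norm (ip u v)"
      by (simp flip: scaleR_2)
    ultimately show ?thesis
      using sym[OF u v] by simp
  qed
  show ?thesis
  proof (cases "x = 0 \<or> y = 0")
    case True
    then show ?thesis
      using ip_scaleR_left[of 0 x y] ip_scaleR_right[of x 0 y] by auto
  next
    case False
    then have "norm (ip ((1 / norm x) *\<^sub>R x) ((1 / norm y) *\<^sub>R y)) \<le> 6"
      by (intro unit) auto
    then show ?thesis
      using False by (simp add: ip_scaleR_left ip_scaleR_right field_simps)
  qed
qed

sublocale ip: bounded_bilinear ip
proof
  show "\<exists>K. \<forall>a b. norm (ip a b) \<le> norm a * norm b * K"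
    using norm_ip_le by (intro exI[of _ 6]) (simp add: ac_simps)
qed (simp_all add: ip_add_left ip_add_right ip_scaleR_left ip_scaleR_right)

text \<open>\<open>P\<close> stays free because the subsequence serves twice: with large norms to
  refute unboundedness, and with no extra demand for the Cesaro means.\<close>

lemma almost_orthogonal_subseq:
  assumes null: "tau_null ip x" and P: "\<And>k. \<exists>\<^sub>F n in sequentially. P k n"
  obtains r :: "nat \<Rightarrow> nat"
  where "strict_mono r" "\<And>k. P k (r k)"
    "\<And>i j. i \<noteq> j \<Longrightarrow> norm (ip (x (r i)) (x (r j))) \<le> (1/2) ^ j"
proof -
  have "\<forall>\<^sub>F n in sequentially. norm (ip (x m) (x n)) \<le> (1/2) ^ k" for k m
  proof -
    have "\<forall>\<^sub>F n in sequentially. norm (ip (x m) (x n)) < (1/2) ^ k"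
      using null unfolding tau_null_def by (intro order_tendstoD(2)[where y = 0]) auto
    then show ?thesis
      by eventually_elim simp
  qed
  then obtain r where r: "strict_mono r" "\<And>k. P k (r k)"
    and le: "\<And>j k. j < k \<Longrightarrow> norm (ip (x (r j)) (x (r k))) \<le> (1/2) ^ k"
    using exists_subseq_frequently_eventually
      [of P "\<lambda>k m n. norm (ip (x m) (x n)) \<le> (1/2) ^ k", OF P] by blast
  \<comment> \<open>The choice controls only pairs with i < j. For i > j, symmetry of the norm gives
    the stronger bound (1/2)^i.\<close>
  have "norm (ip (x (r i)) (x (r j))) \<le> (1/2) ^ j" if "i \<noteq> j" for i j
  proof (cases "i < j")
    case False
    then have "norm (ip (x (r i)) (x (r j))) \<le> (1/2) ^ i"
      using le[of j i] that by (simp add: norm_ip_commute)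
    also have "\<dots> \<le> (1/2) ^ j"
      using False by (intro power_decreasing) auto
    finally show ?thesis .
  qed (rule le)
  with r show thesis
    by (rule that)
qed

lemma tau_null_bounded:
  assumes null: "tau_null ip x"
  shows "Bseq x"
proof (rule ccontr)
  assume unbounded: "\<not> Bseq x"
  have "\<exists>\<^sub>F n in sequentially. 4 ^ k \<le> norm (x n)" for k :: nat
  proof (rule ccontr)
    assume "\<not> (\<exists>\<^sub>F n in sequentially. 4 ^ k \<le> norm (x n))"
    then have "\<forall>\<^sub>F n in sequentially. norm (x n) \<le> 4 ^ k"
      by (auto simp: not_frequently elim: eventually_mono)
    then have "Bseq x"
      by (rule BfunI)
    with unbounded show False ..
  qed
  then obtain r where r: "strict_mono r" and large: "\<And>k. 4 ^ k \<le> norm (x (r k))"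
    and orth: "\<And>i j. i \<noteq> j \<Longrightarrow> norm (ip (x (r i)) (x (r j))) \<le> (1/2) ^ j"
    using almost_orthogonal_subseq[OF null, of "\<lambda>k n. 4 ^ k \<le> norm (x n)"] by blast
  define y where "y k = x (r k)" for k
  have ge1: "1 \<le> norm (y k)" for k
    using large[of k] one_le_power[of "4::real" k] unfolding y_def by linarith
  have nonzero: "y k \<noteq> 0" for k
    using ge1[of k] by auto
  \<comment> \<open>The weights give the terms of the series norm exactly (1/2)^k, so it converges
    absolutely.\<close>
  define c where "c k = (1/2) ^ k / norm (y k)" for k
  have c: "0 \<le> c k" "c k \<le> (1/2) ^ k" for k
    using ge1[of k] frac_le[of "(1/2) ^ k" "(1/2) ^ k" 1 "norm (y k)"] by (auto simp: c_def)
  have cy: "norm (c k *\<^sub>R y k) = (1/2) ^ k" for k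
    using nonzero[of k] by (simp add: c_def)
  have geo: "summable (\<lambda>k. (1/2 :: real) ^ k)"
    by (simp add: summable_geometric)
  have sum_cy: "summable (\<lambda>k. c k *\<^sub>R y k)"
    by (rule summable_norm_cancel) (simp only: cy geo)
  define z where "z = (\<Sum>k. c k *\<^sub>R y k)"
  have bound: "2 ^ k - 2 \<le> norm (ip z (y k))" for k
  proof -
    define f where "f j = ip (c j *\<^sub>R y j) (y k)" for j
    \<comment> \<open>Without its diagonal term the series has norm at most 2, whereas
      \<open>f k\<close> has norm at least (1/2)^k * 4^k = 2^k.\<close>
    define g where "g j = (if j = k then 0 else f j)" for j
    have f: "f sums ip z (y k)"
      unfolding f_def z_def
      by (intro bounded_linear.sums[OF ip.bounded_linear_left] summable_sums sum_cy)
    have "(\<lambda>j. f j - (if j = k then f j else 0)) sums (ip z (y k) - f k)"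
      by (intro sums_diff f sums_single)
    moreover have "(\<lambda>j. f j - (if j = k then f j else 0)) = g"
      by (auto simp: g_def)
    ultimately have g: "g sums (ip z (y k) - f k)"
      by simp
    have "norm (g j) \<le> (1/2) ^ j" for j
    proof (cases "j = k")
      case False
      \<comment> \<open>Here k is fixed, so almost orthogonality supplies only the bound 1; the
        decay in j comes from \<open>c j\<close>.\<close>
      have "norm (ip (y j) (y k)) \<le> (1/2) ^ k"
        using orth[OF False] by (simp add: y_def)
      also have "\<dots> \<le> 1"
        by (simp add: power_le_one)
      finally have "c j * norm (ip (y j) (y k)) \<le> (1/2) ^ j * 1"
        using c by (intro mult_mono) auto
      then show ?thesis
        using False c[of j] by (simp add: g_def f_def ip_scaleR_left)
    qed (simp add: g_def)
    then have "norm (suminf g) \<le> (\<Sum>j. (1/2) ^ j)"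
      by (intro norm_suminf_le geo)
    then have "norm (ip z (y k) - f k) \<le> 2"
      using sums_unique[OF g] by (simp add: suminf_geometric)
    moreover have "norm (f k) = (1/2) ^ k * norm (y k)"
      using nonzero[of k]
      by (simp add: f_def ip_scaleR_left norm_ip_self c_def power2_eq_square)
    moreover have "(1/2) ^ k * 4 ^ k \<le> (1/2) ^ k * norm (y k)"
      using large[of k] unfolding y_def by (intro mult_left_mono) auto
    moreover have "(1/2) ^ k * 4 ^ k = (2::real) ^ k"
      by (simp flip: power_mult_distrib)
    moreover have "norm (f k) \<le> norm (ip z (y k)) + norm (ip z (y k) - f k)"
      by (metis norm_triangle_sub norm_minus_commute)
    ultimately show ?thesis
      by simp
  qed
  have "(\<lambda>k. norm (ip z (y k))) \<longlonglongrightarrow> 0"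
    using LIMSEQ_subseq_LIMSEQ[OF _ r, of "\<lambda>n. norm (ip z (x n))" 0] null
    by (simp add: tau_null_def y_def o_def)
  then have "\<forall>\<^sub>F k in sequentially. norm (ip z (y k)) < 1"
    by (rule order_tendstoD) simp
  \<comment> \<open>From k = 2 on, 2^k - 2 is at least 2, which exceeds the eventual bound
    1.\<close>
  moreover have "\<forall>\<^sub>F k in sequentially. 2 \<le> (k::nat)"
    by (rule eventually_ge_at_top)
  ultimately have "\<forall>\<^sub>F k::nat in sequentially. False"
  proof eventually_elim
    case (elim k)
    then have "(2::real) ^ 2 \<le> 2 ^ k"
      by (intro power_increasing) auto
    with bound[of k] elim show False
      by simp
  qed
  then show False
    by simp
qed

text \<open>In the Gram matrix every row sums to at most M^2 + 2 in norm, so the squared norm of the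
  sum grows linearly, not quadratically, in the number of terms.\<close>

lemma norm_sum_almost_orthogonal_le:
  assumes bounded: "\<And>n. norm (y n) \<le> M"
    and orth: "\<And>i j. i \<noteq> j \<Longrightarrow> norm (ip (y i) (y j)) \<le> (1/2) ^ j"
    and "finite I"
  shows "(norm (\<Sum>i\<in>I. y i))\<^sup>2 \<le> real (card I) * (M\<^sup>2 + 2)"
proof -
  \<comment> \<open>Allowing (1/2)^j on the diagonal too lets one geometric series bound every
    row.\<close>
  have entry: "norm (ip (y i) (y j)) \<le> (if i = j then M\<^sup>2 else 0) + (1/2) ^ j" for i j
    using orth[of i j] power_mono[OF bounded[of i], of 2] by (auto simp: norm_ip_self add_increasing2)
  have "(\<Sum>j\<in>I. (1/2) ^ j) \<le> (\<Sum>j. (1/2 :: real) ^ j)"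
    using \<open>finite I\<close> by (intro sum_le_suminf) (auto simp: summable_geometric)
  then have geo: "(\<Sum>j\<in>I. (1/2) ^ j) \<le> (2 :: real)"
    by (simp add: suminf_geometric)
  have "(norm (\<Sum>i\<in>I. y i))\<^sup>2 = norm (\<Sum>i\<in>I. \<Sum>j\<in>I. ip (y i) (y j))"
    by (simp only: ip.sum_left ip.sum_right flip: norm_ip_self) (rule arg_cong[OF sum.swap])
  also have "\<dots> \<le> (\<Sum>i\<in>I. \<Sum>j\<in>I. norm (ip (y i) (y j)))"
    by (intro order.trans[OF norm_sum] sum_mono norm_sum)
  also have "\<dots> \<le> (\<Sum>i\<in>I. \<Sum>j\<in>I. (if i = j then M\<^sup>2 else 0) + (1/2) ^ j)"
    by (intro sum_mono entry)
  also have "\<dots> = (\<Sum>i\<in>I. M\<^sup>2 + (\<Sum>j\<in>I. (1/2) ^ j))"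
    using \<open>finite I\<close> by (intro sum.cong) (auto simp: sum.distrib)
  also have "\<dots> \<le> (\<Sum>i\<in>I. M\<^sup>2 + 2)"
    using geo by (intro sum_mono) simp
  finally show ?thesis
    by simp
qed

theorem mBS1_ip: "mBS1 ip"
  unfolding mBS1_def
proof (intro allI impI)
  fix x
  assume null: "tau_null ip x"
  from tau_null_bounded[OF null] obtain M where M: "\<And>n. norm (x n) \<le> M"
    by (auto simp: Bseq_def)
  obtain r where r: "strict_mono r"
    and orth: "\<And>i j. i \<noteq> j \<Longrightarrow> norm (ip (x (r i)) (x (r j))) \<le> (1/2) ^ j"
    using almost_orthogonal_subseq[OF null, of "\<lambda>_ _. True"] by auto
  define s where "s k = norm ((1 / real k) *\<^sub>R (\<Sum>i = 1..k. x (r i)))" for k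
  have s_nonneg: "0 \<le> s k" for k
    by (simp add: s_def)
  \<comment> \<open>Dividing the linear bound by k^2 leaves order 1/k. At k = 0 both sides are 0,
    since division by zero yields 0.\<close>
  have le: "(s k)\<^sup>2 \<le> (M\<^sup>2 + 2) * (1 / real k)" for k
  proof -
    have "(norm (\<Sum>i = 1..k. x (r i)))\<^sup>2 \<le> real k * (M\<^sup>2 + 2)"
      using norm_sum_almost_orthogonal_le[of "\<lambda>i. x (r i)" M "{1..k}"] M orth by simp
    then have "(1 / real k)\<^sup>2 * (norm (\<Sum>i = 1..k. x (r i)))\<^sup>2
        \<le> (1 / real k)\<^sup>2 * (real k * (M\<^sup>2 + 2))"
      by (intro mult_left_mono) auto
    moreover have "(s k)\<^sup>2 = (1 / real k)\<^sup>2 * (norm (\<Sum>i = 1..k. x (r i)))\<^sup>2"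
      by (simp only: s_def norm_scaleR power_mult_distrib power2_abs real_norm_def)
    moreover have "(1 / real k)\<^sup>2 * (real k * (M\<^sup>2 + 2)) = (M\<^sup>2 + 2) * (1 / real k)"
      by (cases "k = 0") (simp_all add: power2_eq_square)
    ultimately show ?thesis
      by simp
  qed
  have "(\<lambda>k. (M\<^sup>2 + 2) * (1 / real k)) \<longlonglongrightarrow> 0"
    by (rule tendsto_mult_right_zero[OF lim_1_over_n])
  then have "(\<lambda>k. (s k)\<^sup>2) \<longlonglongrightarrow> 0"
    by (rule real_tendsto_sandwich[OF _ _ tendsto_const, rotated 2])
      (use le in \<open>simp_all del: times_divide_eq_right\<close>)
  then have "s \<longlonglongrightarrow> 0"
    using tendsto_real_sqrt[of "\<lambda>k. (s k)\<^sup>2" 0] by (simp add: s_nonneg)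
  with r show "\<exists>r. strict_mono r \<and>
      (\<lambda>k. norm ((1 / real k) *\<^sub>R (\<Sum>i = 1..k. x (r i)))) \<longlonglongrightarrow> 0"
    unfolding s_def by blast
qed

end

theorem theorem5p3:
  fixes act :: "'v::complex_banach \<Rightarrow> 'a::cstar_algebra \<Rightarrow> 'v"
    and ip :: "'v \<Rightarrow> 'v \<Rightarrow> 'a"
  assumes "hilbert_cstar_module act ip"
  shows "mBS1 ip"
  using assms by (rule hilbert_cstar_module.mBS1_ip)

end
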